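(* The restriction map $\alpha\mapsto(\alpha|_{V_K})_K$ induces a canonical bijection $$\{\text{norms on }V\}\xrightarrow{\ \sim\ }\varprojlim_{K\in\mathcal K(G)}\mathcal B_K^{\mathrm e}.$$ Moreover, for all norms $\alpha,\beta$ on $V$, $$d_\infty(\alpha,\beta)=\sup_{K\in\mathcal K(G)} d_K(\alpha|_{V_K},\beta|_{V_K}),$$ where both sides are allowed to be infinite.
   Context: Let $F$ and $E$ be finite extensions of $\mathbb Q_p$, with a fixed (non-Archimedean, nontrivial) absolute value $|\cdot|$ on $E$. Let $\mathbb G$ be a reductive group over $F$ and $G=\mathbb G(F)$. Let $\pi_{\mathrm{sm}}$ be a smooth admissible $E$-representation of $G$, let $\sigma_{\mathrm{alg}}$ be a finite-dimensional algebraic $E$-representation of $\operatorname{Res}_{F/\mathbb Q_p}\mathbb G$ (viewed as a representation of $G$), and put $V=\pi_{\mathrm{sm}}\otimes_E\sigma_{\mathrm{alg}}$ with the diagonal $G$-action. A norm on an $E$-vector space $W$ is a function $\alpha:W\to\mathbb R_{\ge0}$ with $\alpha(\lambda v)=|\lambda|\alpha(v)$, $\alpha(v+w)\le\max\{\alpha(v),\alpha(w)\}$, and $\alpha(v)=0\Rightarrow v=0$. For two norms on $W$ put $d_\infty(\alpha,\beta)=\sup_{v\in W\setminus\{0\}}\left|\log\frac{\alpha(v)}{\beta(v)}\right|\in[0,+\infty]$ (the supremum over the empty set being $0$). $\mathcal K(G)$ is the set of compact open subgroups of $G$, ordered by reverse inclusion. For $K\in\mathcal K(G)$, $V_K=\pi_{\mathrm{sm}}^K\otimes_E\sigma_{\mathrm{alg}}\subseteq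 V$, which is finite-dimensional, and $V_K\subseteq V_L$ if $L\subseteq K$. $\mathcal B_K^{\mathrm e}$ is the extended Bruhat--Tits building of $\mathrm{GL}(V_K)$ over $E$, realised as the set of norms on $V_K$; $d_K$ denotes the distance $d_\infty$ on norms on $V_K$. For $L\subseteq K$ the transition map of the projective system is restriction $r_{L,K}:\mathcal B_L^{\mathrm e}\to\mathcal B_K^{\mathrm e}$, $x\mapsto x|_{V_K}$. *)

theory Defs
  imports "HOL-Analysis.Analysis" "HOL-Algebra.Algebra"
begin

section \<open>The field of p-adic numbers\<close>

definition padic_abs :: "nat \<Rightarrow> rat \<Rightarrow> real" where
  "padic_abs p q = (if q = 0 then 0 else
     real p powi (int (multiplicity (int p) (snd (quotient_of q)))
                - int (multiplicity (int p) (fst (quotient_of q)))))"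

definition cauchy_ring :: "nat \<Rightarrow> (nat \<Rightarrow> rat) ring" where
  "cauchy_ring p =
    \<lparr>carrier = {s. \<forall>\<epsilon>>0. \<exists>n0. \<forall>m\<ge>n0. \<forall>n\<ge>n0. padic_abs p (s m - s n) < \<epsilon>},
     monoid.mult = (\<lambda>s t n. s n * t n), one = (\<lambda>_. 1),
     ring.zero = (\<lambda>_. 0), add = (\<lambda>s t n. s n + t n)\<rparr>"

definition null_sequences :: "nat \<Rightarrow> (nat \<Rightarrow> rat) set" where
  "null_sequences p = {s. (\<lambda>n. padic_abs p (s n)) \<longlonglongrightarrow> 0}"

type_synonym padic = "(nat \<Rightarrow> rat) set"

definition Qp :: "nat \<Rightarrow> padic ring" where
  "Qp p = cauchy_ring p Quot null_sequences p"

definition Qp_abs :: "nat \<Rightarrow> padic \<Rightarrow> real" where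
  "Qp_abs p x = (THE r. \<exists>s\<in>x. (\<lambda>n. padic_abs p (s n)) \<longlonglongrightarrow> r)"


section \<open>Linear algebra\<close>

definition with_smult :: "('b, 'z) ring_scheme \<Rightarrow> ('a \<Rightarrow> 'b \<Rightarrow> 'b) \<Rightarrow> ('a, 'b) module" where
  "with_smult R s = \<lparr>carrier = carrier R, monoid.mult = monoid.mult R, one = \<one>\<^bsub>R\<^esub>,
     ring.zero = \<zero>\<^bsub>R\<^esub>, add = add R, smult = s\<rparr>"

definition self_algebra :: "('a, 'z) ring_scheme \<Rightarrow> ('a, 'a) module" where
  "self_algebra R = with_smult R (monoid.mult R)"

definition restrict_scalars ::
    "('k, 'e, 'z) module_scheme \<Rightarrow> ('e, 'b, 'y) module_scheme \<Rightarrow> ('k, 'b) module" where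
  "restrict_scalars E R = with_smult R (\<lambda>c x. (c \<odot>\<^bsub>E\<^esub> \<one>\<^bsub>E\<^esub>) \<odot>\<^bsub>R\<^esub> x)"

definition finite_dim :: "('k, 'z) ring_scheme \<Rightarrow> ('k, 'm, 'y) module_scheme \<Rightarrow> bool" where
  "finite_dim K M \<longleftrightarrow> (\<exists>B. finite B \<and> B \<subseteq> carrier M \<and>
     (\<forall>x\<in>carrier M. \<exists>c\<in>B \<rightarrow> carrier K. x = (\<Oplus>\<^bsub>M\<^esub>b\<in>B. c b \<odot>\<^bsub>M\<^esub> b)))"

definition linear_maps ::
    "('k, 'z) ring_scheme \<Rightarrow> ('k, 'm, 'y) module_scheme \<Rightarrow> ('k, 'n, 'x) module_scheme \<Rightarrow> ('m \<Rightarrow> 'n) set" where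
  "linear_maps K M N = {f \<in> carrier M \<rightarrow> carrier N.
     (\<forall>x\<in>carrier M. \<forall>y\<in>carrier M. f (x \<oplus>\<^bsub>M\<^esub> y) = f x \<oplus>\<^bsub>N\<^esub> f y) \<and>
     (\<forall>c\<in>carrier K. \<forall>x\<in>carrier M. f (c \<odot>\<^bsub>M\<^esub> x) = c \<odot>\<^bsub>N\<^esub> f x)}"

definition algebra_homs ::
    "('k, 'z) ring_scheme \<Rightarrow> ('k, 'm, 'y) module_scheme \<Rightarrow> ('k, 'n, 'x) module_scheme \<Rightarrow> ('m \<Rightarrow> 'n) set" where
  "algebra_homs K A B = ring_hom A B \<inter> linear_maps K A B"

definition finite_extension :: "('k, 'z) ring_scheme \<Rightarrow> ('k, 'e, 'y) module_scheme \<Rightarrow> bool" where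
  "finite_extension K E \<longleftrightarrow> Module.algebra K E \<and> field E \<and> finite_dim K E"

definition nonarch_abs :: "('k, 'z) ring_scheme \<Rightarrow> ('k \<Rightarrow> real) \<Rightarrow> bool" where
  "nonarch_abs K v \<longleftrightarrow>
     (\<forall>x\<in>carrier K. 0 \<le> v x \<and> (v x = 0 \<longleftrightarrow> x = \<zero>\<^bsub>K\<^esub>)) \<and>
     (\<forall>x\<in>carrier K. \<forall>y\<in>carrier K. v (x \<otimes>\<^bsub>K\<^esub> y) = v x * v y) \<and>
     (\<forall>x\<in>carrier K. \<forall>y\<in>carrier K. v (x \<oplus>\<^bsub>K\<^esub> y) \<le> max (v x) (v y))"

definition nontrivial_abs :: "('k, 'z) ring_scheme \<Rightarrow> ('k \<Rightarrow> real) \<Rightarrow> bool" where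
  "nontrivial_abs K v \<longleftrightarrow> (\<exists>x\<in>carrier K. x \<noteq> \<zero>\<^bsub>K\<^esub> \<and> v x \<noteq> 1)"


section \<open>Tensor products\<close>

text \<open>
  The tensor product of two \<open>K\<close>-modules is the free \<open>K\<close>-module on \<open>carrier M \<times> carrier N\<close> modulo
  the bilinearity relations. The convolution product on the free module induces the usual product
  \<open>(x \<otimes> y)(x' \<otimes> y') = xx' \<otimes> yy'\<close> when \<open>M\<close> and \<open>N\<close> are \<open>K\<close>-algebras; for mere modules the fields
  \<open>mult\<close> and \<open>one\<close> of the tensor product carry no meaning.
\<close>

definition delta :: "('k, 'z) ring_scheme \<Rightarrow> 'm \<Rightarrow> 'n \<Rightarrow> 'm \<times> 'n \<Rightarrow> 'k" where
  "delta K x y = (\<lambda>z. if z = (x, y) then \<one>\<^bsub>K\<^esub> else \<zero>\<^bsub>K\<^esub>)"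

definition free_module ::
    "('k, 'z) ring_scheme \<Rightarrow> ('k, 'm, 'y) module_scheme \<Rightarrow> ('k, 'n, 'x) module_scheme
      \<Rightarrow> ('k, 'm \<times> 'n \<Rightarrow> 'k) module" where
  "free_module K M N =
    \<lparr>carrier = {u. (\<forall>z. u z \<in> carrier K) \<and> finite {z. u z \<noteq> \<zero>\<^bsub>K\<^esub>} \<and>
                   {z. u z \<noteq> \<zero>\<^bsub>K\<^esub>} \<subseteq> carrier M \<times> carrier N},
     monoid.mult = (\<lambda>u v z. \<Oplus>\<^bsub>K\<^esub>w\<in>{(s, t). u s \<noteq> \<zero>\<^bsub>K\<^esub> \<and> v t \<noteq> \<zero>\<^bsub>K\<^esub> \<and>
                 (fst s \<otimes>\<^bsub>M\<^esub> fst t, snd s \<otimes>\<^bsub>N\<^esub> snd t) = z}. u (fst w) \<otimes>\<^bsub>K\<^esub> v (snd w)),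
     one = delta K \<one>\<^bsub>M\<^esub> \<one>\<^bsub>N\<^esub>,
     ring.zero = (\<lambda>z. \<zero>\<^bsub>K\<^esub>),
     add = (\<lambda>u v z. u z \<oplus>\<^bsub>K\<^esub> v z),
     smult = (\<lambda>c u z. c \<otimes>\<^bsub>K\<^esub> u z)\<rparr>"

definition bilinearity_relations ::
    "('k, 'z) ring_scheme \<Rightarrow> ('k, 'm, 'y) module_scheme \<Rightarrow> ('k, 'n, 'x) module_scheme
      \<Rightarrow> ('m \<times> 'n \<Rightarrow> 'k) set" where
  "bilinearity_relations K M N =
     {\<lambda>z. delta K (x \<oplus>\<^bsub>M\<^esub> x') y z \<ominus>\<^bsub>K\<^esub> (delta K x y z \<oplus>\<^bsub>K\<^esub> delta K x' y z) | x x' y.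
        x \<in> carrier M \<and> x' \<in> carrier M \<and> y \<in> carrier N} \<union>
     {\<lambda>z. delta K x (y \<oplus>\<^bsub>N\<^esub> y') z \<ominus>\<^bsub>K\<^esub> (delta K x y z \<oplus>\<^bsub>K\<^esub> delta K x y' z) | x y y'.
        x \<in> carrier M \<and> y \<in> carrier N \<and> y' \<in> carrier N} \<union>
     {\<lambda>z. delta K (c \<odot>\<^bsub>M\<^esub> x) y z \<ominus>\<^bsub>K\<^esub> c \<otimes>\<^bsub>K\<^esub> delta K x y z | c x y.
        c \<in> carrier K \<and> x \<in> carrier M \<and> y \<in> carrier N} \<union>
     {\<lambda>z. delta K x (c \<odot>\<^bsub>N\<^esub> y) z \<ominus>\<^bsub>K\<^esub> c \<otimes>\<^bsub>K\<^esub> delta K x y z | c x y.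
        c \<in> carrier K \<and> x \<in> carrier M \<and> y \<in> carrier N}"

definition tensor_rel ::
    "('k, 'z) ring_scheme \<Rightarrow> ('k, 'm, 'y) module_scheme \<Rightarrow> ('k, 'n, 'x) module_scheme
      \<Rightarrow> ('m \<times> 'n \<Rightarrow> 'k) set" where
  "tensor_rel K M N = (\<lambda>H. submodule H K (free_module K M N)) hull bilinearity_relations K M N"

definition tensor ::
    "('k, 'z) ring_scheme \<Rightarrow> ('k, 'm, 'y) module_scheme \<Rightarrow> ('k, 'n, 'x) module_scheme
      \<Rightarrow> ('k, ('m \<times> 'n \<Rightarrow> 'k) set) module" where
  "tensor K M N = with_smult (free_module K M N Quot tensor_rel K M N)
     (\<lambda>c \<xi>. \<Union>u\<in>\<xi>. tensor_rel K M N +>\<^bsub>free_module K M N\<^esub> (c \<odot>\<^bsub>free_module K M N\<^esub> u))"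

definition pure_tensor ::
    "('k, 'z) ring_scheme \<Rightarrow> ('k, 'm, 'y) module_scheme \<Rightarrow> ('k, 'n, 'x) module_scheme
      \<Rightarrow> 'm \<Rightarrow> 'n \<Rightarrow> ('m \<times> 'n \<Rightarrow> 'k) set" where
  "pure_tensor K M N x y = tensor_rel K M N +>\<^bsub>free_module K M N\<^esub> delta K x y"

text \<open>The linear map out of a tensor product induced by a bilinear map \<open>f\<close> into \<open>P\<close>; for bilinear
  \<open>f\<close> the value does not depend on the chosen representative.\<close>

definition tensor_lift ::
    "('k, 'z) ring_scheme \<Rightarrow> ('k, 'p, 'y) module_scheme \<Rightarrow> ('m \<Rightarrow> 'n \<Rightarrow> 'p) \<Rightarrow> ('m \<times> 'n \<Rightarrow> 'k) set \<Rightarrow> 'p" where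
  "tensor_lift K P f \<xi> = (let u = (SOME u. u \<in> \<xi>) in
     \<Oplus>\<^bsub>P\<^esub>z\<in>{z. u z \<noteq> \<zero>\<^bsub>K\<^esub>}. u z \<odot>\<^bsub>P\<^esub> f (fst z) (snd z))"

text \<open>The map \<open>f \<otimes> g\<close> with values in \<open>M' \<otimes> N'\<close>.\<close>

definition tensor_map ::
    "('k, 'z) ring_scheme \<Rightarrow> ('k, 'm2, 'y) module_scheme \<Rightarrow> ('k, 'n2, 'x) module_scheme
      \<Rightarrow> ('m \<Rightarrow> 'm2) \<Rightarrow> ('n \<Rightarrow> 'n2) \<Rightarrow> ('m \<times> 'n \<Rightarrow> 'k) set \<Rightarrow> ('m2 \<times> 'n2 \<Rightarrow> 'k) set" where
  "tensor_map K M' N' f g =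
     tensor_lift K (tensor K M' N') (\<lambda>x y. pure_tensor K M' N' (f x) (g y))"

text \<open>The image of \<open>U \<otimes> N \<rightarrow> M \<otimes> N\<close> for a submodule \<open>U\<close> of \<open>M\<close>: the classes having a representative
  in the free module on \<open>U \<times> carrier N\<close>.\<close>

definition tensor_subspace ::
    "('k, 'z) ring_scheme \<Rightarrow> ('k, 'm, 'y) module_scheme \<Rightarrow> ('k, 'n, 'x) module_scheme
      \<Rightarrow> 'm set \<Rightarrow> ('m \<times> 'n \<Rightarrow> 'k) set set" where
  "tensor_subspace K M N U =
     {\<xi> \<in> carrier (tensor K M N). \<xi> \<inter> carrier (free_module K (M\<lparr>carrier := U\<rparr>) N) \<noteq> {}}"

text \<open>\<open>M \<otimes>\<^sub>K R\<close> as a module over its right factor, and \<open>R \<otimes>\<^sub>K S\<close> as an algebra over its left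
  factor.\<close>

definition base_change ::
    "('k, 'z) ring_scheme \<Rightarrow> ('k, 'm, 'y) module_scheme \<Rightarrow> ('k, 'r, 'x) module_scheme
      \<Rightarrow> ('r, ('m \<times> 'r \<Rightarrow> 'k) set) module" where
  "base_change K M R = with_smult (tensor K M R)
     (\<lambda>r. tensor_map K M R (\<lambda>x. x) (\<lambda>s. r \<otimes>\<^bsub>R\<^esub> s))"

definition left_tensor_algebra ::
    "('k, 'z) ring_scheme \<Rightarrow> ('k, 'r, 'y) module_scheme \<Rightarrow> ('k, 's, 'x) module_scheme
      \<Rightarrow> ('r, ('r \<times> 's \<Rightarrow> 'k) set) module" where
  "left_tensor_algebra K R S = with_smult (tensor K R S)
     (\<lambda>r. tensor_map K R S (\<lambda>x. r \<otimes>\<^bsub>R\<^esub> x) (\<lambda>s. s))"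


section \<open>Affine algebraic groups\<close>

text \<open>
  An affine algebraic group over \<open>F\<close> is given by its coordinate ring: a finitely generated
  commutative Hopf algebra \<open>A\<close> over \<open>F\<close> with comultiplication \<open>\<Delta>\<close> and counit \<open>\<epsilon>\<close> (the antipode
  is unique when it exists). Its points with values in a commutative \<open>F\<close>-algebra \<open>R\<close> are the
  \<open>F\<close>-algebra homomorphisms \<open>A \<rightarrow> R\<close>, normalised to be \<open>undefined\<close> outside \<open>carrier A\<close>.
\<close>

definition hopf_algebra ::
    "('f, 'z) ring_scheme \<Rightarrow> ('f, 'a, 'y) module_scheme \<Rightarrow> ('a \<Rightarrow> ('a \<times> 'a \<Rightarrow> 'f) set)
      \<Rightarrow> ('a \<Rightarrow> 'f) \<Rightarrow> bool" where
  "hopf_algebra F A \<Delta> \<epsilon> \<longleftrightarrow>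
     Module.algebra F A \<and>
     \<Delta> \<in> algebra_homs F A (tensor F A A) \<and>
     \<epsilon> \<in> algebra_homs F A (self_algebra F) \<and>
     (\<forall>a\<in>carrier A.
        tensor_lift F (tensor F A (tensor F A A))
          (\<lambda>x y. pure_tensor F A (tensor F A A) x (\<Delta> y)) (\<Delta> a) =
        tensor_lift F (tensor F A (tensor F A A))
          (\<lambda>x y. tensor_lift F (tensor F A (tensor F A A))
             (\<lambda>x1 x2. pure_tensor F A (tensor F A A) x1 (pure_tensor F A A x2 y)) (\<Delta> x)) (\<Delta> a)) \<and>
     (\<forall>a\<in>carrier A.
        tensor_lift F A (\<lambda>x y. \<epsilon> x \<odot>\<^bsub>A\<^esub> y) (\<Delta> a) = a \<and>
        tensor_lift F A (\<lambda>x y. \<epsilon> y \<odot>\<^bsub>A\<^esub> x) (\<Delta> a) = a) \<and>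
     (\<exists>S\<in>linear_maps F A A. \<forall>a\<in>carrier A.
        tensor_lift F A (\<lambda>x y. S x \<otimes>\<^bsub>A\<^esub> y) (\<Delta> a) = \<epsilon> a \<odot>\<^bsub>A\<^esub> \<one>\<^bsub>A\<^esub> \<and>
        tensor_lift F A (\<lambda>x y. x \<otimes>\<^bsub>A\<^esub> S y) (\<Delta> a) = \<epsilon> a \<odot>\<^bsub>A\<^esub> \<one>\<^bsub>A\<^esub>)"

definition finitely_generated_algebra ::
    "('f, 'z) ring_scheme \<Rightarrow> ('f, 'a, 'y) module_scheme \<Rightarrow> bool" where
  "finitely_generated_algebra F A \<longleftrightarrow> (\<exists>B0. finite B0 \<and> B0 \<subseteq> carrier A \<and>
     (\<forall>B. subring B A \<and> (\<forall>c\<in>carrier F. \<forall>b\<in>B. c \<odot>\<^bsub>A\<^esub> b \<in> B) \<and> B0 \<subseteq> B \<longrightarrow> B = carrier A))"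

definition point_group ::
    "('f, 'z) ring_scheme \<Rightarrow> ('f, 'a, 'y) module_scheme \<Rightarrow> ('a \<Rightarrow> ('a \<times> 'a \<Rightarrow> 'f) set)
      \<Rightarrow> ('a \<Rightarrow> 'f) \<Rightarrow> ('f, 'r, 'x) module_scheme \<Rightarrow> ('a \<Rightarrow> 'r) monoid" where
  "point_group F A \<Delta> \<epsilon> R =
    \<lparr>carrier = extensional (carrier A) \<inter> algebra_homs F A R,
     monoid.mult = (\<lambda>g h. \<lambda>a\<in>carrier A. tensor_lift F R (\<lambda>x y. g x \<otimes>\<^bsub>R\<^esub> h y) (\<Delta> a)),
     one = (\<lambda>a\<in>carrier A. \<epsilon> a \<odot>\<^bsub>R\<^esub> \<one>\<^bsub>R\<^esub>)\<rparr>"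

subsection \<open>Reductive groups\<close>

text \<open>The embedding of a field into its algebraic closure in the library is \<open>indexed_const\<close>.\<close>

definition closure_algebra ::
    "('f, 'z) ring_scheme \<Rightarrow> ('f, ('f list \<times> nat) multiset \<Rightarrow> 'f) module" where
  "closure_algebra F = with_smult (field.alg_closure F)
     (\<lambda>c x. ring.indexed_const F c \<otimes>\<^bsub>field.alg_closure F\<^esub> x)"

text \<open>For an \<open>F\<close>-algebra \<open>L\<close> that is an algebraically closed field, the regular functions on the set
  \<open>H\<close> of \<open>L\<close>-points are the \<open>L\<close>-linear combinations of the functions \<open>g \<mapsto> g(a)\<close> for \<open>a\<close> in \<open>A\<close>.\<close>

definition regular_functions ::
    "('f, 'a, 'y) module_scheme \<Rightarrow> ('f, 'l, 'x) module_scheme \<Rightarrow> ('a \<Rightarrow> 'l) set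
      \<Rightarrow> (('a \<Rightarrow> 'l) \<Rightarrow> 'l) set" where
  "regular_functions A L H =
     {\<lambda>g\<in>H. \<Oplus>\<^bsub>L\<^esub>a\<in>I. c a \<otimes>\<^bsub>L\<^esub> g a | I c. finite I \<and> I \<subseteq> carrier A \<and> c \<in> I \<rightarrow> carrier L}"

definition zariski_topology ::
    "('f, 'a, 'y) module_scheme \<Rightarrow> ('f, 'l, 'x) module_scheme \<Rightarrow> ('a \<Rightarrow> 'l) set
      \<Rightarrow> ('a \<Rightarrow> 'l) topology" where
  "zariski_topology A L H =
     topology_generated_by {{g \<in> H. f g \<noteq> \<zero>\<^bsub>L\<^esub>} | f. f \<in> regular_functions A L H}"

text \<open>An element \<open>g\<close> is unipotent iff right translation by \<open>g\<close> minus the identity is locally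
  nilpotent on the regular functions.\<close>

definition unipotent ::
    "('f, 'a, 'y) module_scheme \<Rightarrow> ('f, 'l, 'x) module_scheme \<Rightarrow> ('a \<Rightarrow> 'l) monoid
      \<Rightarrow> ('a \<Rightarrow> 'l) \<Rightarrow> bool" where
  "unipotent A L H g \<longleftrightarrow> (\<forall>f\<in>regular_functions A L (carrier H). \<exists>k.
     ((\<lambda>f'. \<lambda>h\<in>carrier H. f' (h \<otimes>\<^bsub>H\<^esub> g) \<ominus>\<^bsub>L\<^esub> f' h) ^^ k) f = (\<lambda>h\<in>carrier H. \<zero>\<^bsub>L\<^esub>))"

text \<open>
  Reductive: the unipotent radical over an algebraic closure, i.e. the largest connected unipotent
  normal closed subgroup, is trivial. The base field is assumed to have characteristic 0, so that
  algebraic groups are smooth and geometric points suffice. Connectedness is not demanded.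
\<close>

definition reductive_group ::
    "('f, 'z) ring_scheme \<Rightarrow> ('f, 'a, 'y) module_scheme \<Rightarrow> ('a \<Rightarrow> ('a \<times> 'a \<Rightarrow> 'f) set)
      \<Rightarrow> ('a \<Rightarrow> 'f) \<Rightarrow> bool" where
  "reductive_group F A \<Delta> \<epsilon> \<longleftrightarrow>
     hopf_algebra F A \<Delta> \<epsilon> \<and> finitely_generated_algebra F A \<and>
     (let L = closure_algebra F; H = point_group F A \<Delta> \<epsilon> L;
          Z = zariski_topology A L (carrier H)
      in \<forall>U. U \<lhd> H \<and> closedin Z U \<and> connectedin Z U \<and> (\<forall>g\<in>U. unipotent A L H g)
           \<longrightarrow> U = {\<one>\<^bsub>H\<^esub>})"

subsection \<open>Rational points\<close>

definition rational_points ::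
    "('f, 'z) ring_scheme \<Rightarrow> ('f, 'a, 'y) module_scheme \<Rightarrow> ('a \<Rightarrow> ('a \<times> 'a \<Rightarrow> 'f) set)
      \<Rightarrow> ('a \<Rightarrow> 'f) \<Rightarrow> ('a \<Rightarrow> 'f) monoid" where
  "rational_points F A \<Delta> \<epsilon> = point_group F A \<Delta> \<epsilon> (self_algebra F)"

text \<open>The coarsest topology on a set \<open>G\<close> of \<open>F\<close>-points making \<open>g \<mapsto> g(a)\<close> continuous for all \<open>a\<close>
  in \<open>A\<close>, where \<open>F\<close> has the topology of the absolute value \<open>v\<close>.\<close>

definition points_topology ::
    "('f, 'z) ring_scheme \<Rightarrow> ('f \<Rightarrow> real) \<Rightarrow> 'a set \<Rightarrow> ('a \<Rightarrow> 'f) set \<Rightarrow> ('a \<Rightarrow> 'f) topology" where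
  "points_topology F v A G = subtopology
     (product_topology (\<lambda>_. Metric_space.mtopology (carrier F) (\<lambda>x y. v (x \<ominus>\<^bsub>F\<^esub> y))) A) G"

definition compact_open_subgroups :: "('g, 'z) monoid_scheme \<Rightarrow> 'g topology \<Rightarrow> 'g set set" where
  "compact_open_subgroups G T = {K. subgroup K G \<and> compactin T K \<and> openin T K}"


section \<open>Representations\<close>

definition representation ::
    "('k, 'z) ring_scheme \<Rightarrow> ('g, 'y) monoid_scheme \<Rightarrow> ('k, 'm, 'x) module_scheme
      \<Rightarrow> ('g \<Rightarrow> 'm \<Rightarrow> 'm) \<Rightarrow> bool" where
  "representation K G M \<rho> \<longleftrightarrow> Module.module K M \<and> group_action G (carrier M) \<rho> \<and>
     (\<forall>g\<in>carrier G. \<rho> g \<in> linear_maps K M M)"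

definition fixed_vectors :: "('m, 'z) partial_object_scheme \<Rightarrow> ('g \<Rightarrow> 'm \<Rightarrow> 'm) \<Rightarrow> 'g set \<Rightarrow> 'm set" where
  "fixed_vectors M \<rho> K = {x \<in> carrier M. \<forall>g\<in>K. \<rho> g x = x}"

text \<open>Smoothness is expressed by \<open>M\<close> being the union of its subspaces of vectors fixed by compact open
  subgroups.\<close>

definition smooth_admissible ::
    "('k, 'z) ring_scheme \<Rightarrow> ('g, 'y) monoid_scheme \<Rightarrow> 'g topology \<Rightarrow> ('k, 'm, 'x) module_scheme
      \<Rightarrow> ('g \<Rightarrow> 'm \<Rightarrow> 'm) \<Rightarrow> bool" where
  "smooth_admissible k G T M \<rho> \<longleftrightarrow> representation k G M \<rho> \<and>
     (\<forall>x\<in>carrier M. \<exists>K\<in>compact_open_subgroups G T. x \<in> fixed_vectors M \<rho> K) \<and>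
     (\<forall>K\<in>compact_open_subgroups G T. finite_dim k (M\<lparr>carrier := fixed_vectors M \<rho> K\<rparr>))"

text \<open>
  Let \<open>\<GG>\<close> be the \<open>F\<close>-group given by \<open>(A, \<Delta>, \<epsilon>)\<close>. The Weil restriction of \<open>\<GG>\<close> from \<open>F\<close> to \<open>Q\<close> sends
  a commutative \<open>Q\<close>-algebra \<open>R\<close> to \<open>\<GG>(F \<otimes>\<^sub>Q R)\<close>.
\<close>

definition weil_points ::
    "('q, 'z) ring_scheme \<Rightarrow> ('q, 'f, 'y) module_scheme \<Rightarrow> ('f, 'a, 'x) module_scheme
      \<Rightarrow> ('a \<Rightarrow> ('a \<times> 'a \<Rightarrow> 'f) set) \<Rightarrow> ('a \<Rightarrow> 'f) \<Rightarrow> ('q, 'r, 'w) module_scheme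
      \<Rightarrow> ('a \<Rightarrow> ('f \<times> 'r \<Rightarrow> 'q) set) monoid" where
  "weil_points Q F A \<Delta> \<epsilon> R = point_group F A \<Delta> \<epsilon> (left_tensor_algebra Q F R)"

text \<open>
  An algebraic representation over \<open>E\<close> of the Weil restriction on an \<open>E\<close>-vector space \<open>N\<close> is a family
  of \<open>R\<close>-linear actions of \<open>\<GG>(F \<otimes>\<^sub>Q R)\<close> on \<open>N \<otimes>\<^sub>E R\<close>, natural in the commutative \<open>E\<close>-algebra \<open>R\<close>.
  It suffices to let \<open>R\<close> range over the algebras whose elements are taken from the type of elements
  of \<open>E\<close>: as \<open>E\<close> is infinite, every finitely generated commutative \<open>E\<close>-algebra is isomorphic to one
  of these, and the base change to \<open>E\<close> of the Weil restriction is represented by a finitely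
  generated algebra, so that Yoneda's lemma applies.
  The representation \<open>\<sigma>\<close> of \<open>G = \<GG>(F)\<close> on \<open>N\<close> is obtained from it via \<open>\<GG>(F) \<rightarrow> \<GG>(F \<otimes>\<^sub>Q E)\<close> and
  \<open>N \<cong> N \<otimes>\<^sub>E E\<close>.
\<close>

definition algebraic_representation ::
    "('q, 'z) ring_scheme \<Rightarrow> ('q, 'f, 'y) module_scheme \<Rightarrow> ('q, 'e, 'x) module_scheme
      \<Rightarrow> ('f, 'a, 'w) module_scheme \<Rightarrow> ('a \<Rightarrow> ('a \<times> 'a \<Rightarrow> 'f) set) \<Rightarrow> ('a \<Rightarrow> 'f)
      \<Rightarrow> ('e, 'n, 'v) module_scheme \<Rightarrow> (('a \<Rightarrow> 'f) \<Rightarrow> 'n \<Rightarrow> 'n) \<Rightarrow> bool" where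
  "algebraic_representation Q F E A \<Delta> \<epsilon> N \<sigma> \<longleftrightarrow>
     representation E (rational_points F A \<Delta> \<epsilon>) N \<sigma> \<and>
     (\<exists>\<rho> :: ('e, 'e) module \<Rightarrow> ('a \<Rightarrow> ('f \<times> 'e \<Rightarrow> 'q) set) \<Rightarrow> ('n \<times> 'e \<Rightarrow> 'e) set \<Rightarrow> ('n \<times> 'e \<Rightarrow> 'e) set.
        (\<forall>R. Module.algebra E R \<longrightarrow>
           representation R (weil_points Q F A \<Delta> \<epsilon> (restrict_scalars E R)) (base_change E N R) (\<rho> R)) \<and>
        (\<forall>R R' \<phi>. Module.algebra E R \<and> Module.algebra E R' \<and> \<phi> \<in> algebra_homs E R R' \<longrightarrow>
           (\<forall>g\<in>carrier (weil_points Q F A \<Delta> \<epsilon> (restrict_scalars E R)). \<forall>\<xi>\<in>carrier (tensor E N R).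
              \<rho> R' (\<lambda>a\<in>carrier A. tensor_map Q F (restrict_scalars E R') (\<lambda>x. x) \<phi> (g a))
                (tensor_map E N R' (\<lambda>x. x) \<phi> \<xi>) =
              tensor_map E N R' (\<lambda>x. x) \<phi> (\<rho> R g \<xi>))) \<and>
        (\<forall>g\<in>carrier (rational_points F A \<Delta> \<epsilon>). \<forall>y\<in>carrier N.
           \<rho> (self_algebra E)
             (\<lambda>a\<in>carrier A. pure_tensor Q F (restrict_scalars E (self_algebra E)) (g a) \<one>\<^bsub>E\<^esub>)
             (pure_tensor E N (self_algebra E) y \<one>\<^bsub>E\<^esub>) =
           pure_tensor E N (self_algebra E) (\<sigma> g y) \<one>\<^bsub>E\<^esub>))"


section \<open>Norms\<close>

text \<open>Norms are functions on the carrier, normalised to be \<open>undefined\<close> outside it.\<close>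

definition norms :: "('k, 'z) ring_scheme \<Rightarrow> ('k \<Rightarrow> real) \<Rightarrow> ('k, 'm, 'y) module_scheme \<Rightarrow> ('m \<Rightarrow> real) set" where
  "norms k v W = {\<alpha> \<in> carrier W \<rightarrow>\<^sub>E {0..}.
     (\<forall>c\<in>carrier k. \<forall>x\<in>carrier W. \<alpha> (c \<odot>\<^bsub>W\<^esub> x) = v c * \<alpha> x) \<and>
     (\<forall>x\<in>carrier W. \<forall>y\<in>carrier W. \<alpha> (x \<oplus>\<^bsub>W\<^esub> y) \<le> max (\<alpha> x) (\<alpha> y)) \<and>
     (\<forall>x\<in>carrier W. \<alpha> x = 0 \<longrightarrow> x = \<zero>\<^bsub>W\<^esub>)}"

text \<open>The supremum is taken in \<open>[0, \<infinity>]\<close>, so that it is \<open>0\<close> for \<open>W = 0\<close>.\<close>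

definition d_infty :: "('k, 'm, 'y) module_scheme \<Rightarrow> ('m \<Rightarrow> real) \<Rightarrow> ('m \<Rightarrow> real) \<Rightarrow> ennreal" where
  "d_infty W \<alpha> \<beta> = (SUP x\<in>carrier W - {\<zero>\<^bsub>W\<^esub>}. ennreal \<bar>ln (\<alpha> x / \<beta> x)\<bar>)"

text \<open>The extended Bruhat--Tits building of \<open>GL(W)\<close>, realised as a set of norms.\<close>

definition extended_building ::
    "('k, 'z) ring_scheme \<Rightarrow> ('k \<Rightarrow> real) \<Rightarrow> ('k, 'm, 'y) module_scheme \<Rightarrow> ('m \<Rightarrow> real) set" where
  "extended_building k v W = norms k v W"

definition level_space ::
    "('k, 'z) ring_scheme \<Rightarrow> ('k, 'm, 'y) module_scheme \<Rightarrow> ('g \<Rightarrow> 'm \<Rightarrow> 'm)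
      \<Rightarrow> ('k, 'n, 'x) module_scheme \<Rightarrow> 'g set \<Rightarrow> ('k, ('m \<times> 'n \<Rightarrow> 'k) set) module" where
  "level_space k M \<pi> N K =
     (tensor k M N)\<lparr>carrier := tensor_subspace k M N (fixed_vectors M \<pi> K)\<rparr>"

text \<open>The projective limit along restriction of functions of the sets \<open>B K\<close> of functions on \<open>D K\<close>,
  over an index set \<open>I\<close> of sets ordered by reverse inclusion.\<close>

definition restriction_limit ::
    "'g set set \<Rightarrow> ('g set \<Rightarrow> 'v set) \<Rightarrow> ('g set \<Rightarrow> ('v \<Rightarrow> real) set) \<Rightarrow> ('g set \<Rightarrow> 'v \<Rightarrow> real) set" where
  "restriction_limit I D B =
     {x \<in> Pi\<^sub>E I B. \<forall>K\<in>I. \<forall>L\<in>I. L \<subseteq> K \<longrightarrow> restrict (x L) (D K) = x K}"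

end

theory Submission
  imports Defs
begin

text \<open>
  The idea is that \<open>V\<close> is the directed union of the subspaces \<open>V\<^sub>K\<close>, and that the axioms of a norm
  involve only finitely many vectors at a time. A norm is therefore determined by its restrictions
  to the \<open>V\<^sub>K\<close>, and a compatible family of norms glues: each axiom can be checked inside a single
  \<open>V\<^sub>K\<close> containing the vectors concerned (\<open>norms_on_directed_union\<close>). The distance formula
  is the statement that a supremum over a union is the supremum of the suprema
  (\<open>d_infty_union\<close>).

  So the content is that the union is exhaustive and directed. Every vector of the smooth
  representation is fixed by a compact open subgroup, and a vector of the tensor product involves
  only finitely many such vectors, so that the claim reduces to the intersection of two compact open
  subgroups being compact open (\<open>tensor_carrier_directed_union\<close>,
  \<open>compact_open_subgroups_Int\<close>). Compactness of the intersection holds because open subgroups are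
  closed, being the complement of the union of their other cosets. This argument rests on the
  continuity of left translations of \<open>G\<close> (\<open>continuous_map_left_translation\<close>), a consequence of the
  comultiplication being a map \<open>A \<rightarrow> A \<otimes> A\<close>: if \<open>a\<close> is a regular function, so is \<open>g \<mapsto> a(hg)\<close>.
\<close>

section \<open>Norms on directed unions of subspaces\<close>

lemma restrict_norm_to_subspace:
  assumes "\<alpha> \<in> norms k v V" and "D \<subseteq> carrier V"
    and "\<And>x y. x \<in> D \<Longrightarrow> y \<in> D \<Longrightarrow> x \<oplus>\<^bsub>V\<^esub> y \<in> D"
    and "\<And>c x. c \<in> carrier k \<Longrightarrow> x \<in> D \<Longrightarrow> c \<odot>\<^bsub>V\<^esub> x \<in> D"
  shows "restrict \<alpha> D \<in> norms k v (V\<lparr>carrier := D\<rparr>)"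
  using assms unfolding norms_def by (auto simp: PiE_iff subset_iff)

text \<open>Gluing: the index sets are ordered by reverse inclusion, so that \<open>directed\<close> and \<open>antimono\<close>
  place any two vectors in a common \<open>D P\<close>, where the norm axioms of the given family apply.\<close>

lemma norms_on_directed_union:
  assumes cover: "carrier V = (\<Union>K\<in>I. D K)"
    and add: "\<And>K x y. K \<in> I \<Longrightarrow> x \<in> D K \<Longrightarrow> y \<in> D K \<Longrightarrow> x \<oplus>\<^bsub>V\<^esub> y \<in> D K"
    and smult: "\<And>K c x. K \<in> I \<Longrightarrow> c \<in> carrier k \<Longrightarrow> x \<in> D K \<Longrightarrow> c \<odot>\<^bsub>V\<^esub> x \<in> D K"
    and directed: "\<And>K L. K \<in> I \<Longrightarrow> L \<in> I \<Longrightarrow> \<exists>P\<in>I. P \<subseteq> K \<and> P \<subseteq> L"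
    and antimono: "\<And>K L. K \<in> I \<Longrightarrow> L \<in> I \<Longrightarrow> L \<subseteq> K \<Longrightarrow> D K \<subseteq> D L"
  shows "bij_betw (\<lambda>\<alpha>. \<lambda>K\<in>I. restrict \<alpha> (D K)) (norms k v V)
           (restriction_limit I D (\<lambda>K. norms k v (V\<lparr>carrier := D K\<rparr>)))"
proof (rule bij_betw_imageI)
  show "inj_on (\<lambda>\<alpha>. \<lambda>K\<in>I. restrict \<alpha> (D K)) (norms k v V)"
  proof (rule inj_onI)
    fix \<alpha> \<beta>
    assume norms: "\<alpha> \<in> norms k v V" "\<beta> \<in> norms k v V"
      and eq: "(\<lambda>K\<in>I. restrict \<alpha> (D K)) = (\<lambda>K\<in>I. restrict \<beta> (D K))"
    show "\<alpha> = \<beta>"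
    proof (rule extensionalityI)
      show "\<alpha> \<in> extensional (carrier V)" "\<beta> \<in> extensional (carrier V)"
        using norms by (auto simp: norms_def PiE_def)
      fix x assume "x \<in> carrier V"
      then obtain K where K: "K \<in> I" "x \<in> D K" using cover by auto
      have "restrict \<alpha> (D K) x = restrict \<beta> (D K) x"
        using fun_cong[OF eq, of K] K(1) by simp
      then show "\<alpha> x = \<beta> x" using K(2) by simp
    qed
  qed
  show "(\<lambda>\<alpha>. \<lambda>K\<in>I. restrict \<alpha> (D K)) ` norms k v V =
          restriction_limit I D (\<lambda>K. norms k v (V\<lparr>carrier := D K\<rparr>))"
  proof (intro equalityI subsetI)
    fix f assume "f \<in> (\<lambda>\<alpha>. \<lambda>K\<in>I. restrict \<alpha> (D K)) ` norms k v V"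
    then obtain \<alpha> where \<alpha>: "\<alpha> \<in> norms k v V" and f: "f = (\<lambda>K\<in>I. restrict \<alpha> (D K))" by auto
    have "restrict \<alpha> (D K) \<in> norms k v (V\<lparr>carrier := D K\<rparr>)" if "K \<in> I" for K
      using that cover add smult by (intro restrict_norm_to_subspace[OF \<alpha>]) auto
    moreover have "restrict (restrict \<alpha> (D L)) (D K) = restrict \<alpha> (D K)"
      if "K \<in> I" "L \<in> I" "L \<subseteq> K" for K L
      using antimono[OF that] by (auto simp: restrict_def fun_eq_iff)
    ultimately show "f \<in> restriction_limit I D (\<lambda>K. norms k v (V\<lparr>carrier := D K\<rparr>))"
      unfolding restriction_limit_def f by auto
  next
    fix f assume f: "f \<in> restriction_limit I D (\<lambda>K. norms k v (V\<lparr>carrier := D K\<rparr>))"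
    then have fK: "f K \<in> norms k v (V\<lparr>carrier := D K\<rparr>)" if "K \<in> I" for K
      using that by (auto simp: restriction_limit_def)
    have f_restrict: "restrict (f L) (D K) = f K" if "K \<in> I" "L \<in> I" "L \<subseteq> K" for K L
      using f that by (auto simp: restriction_limit_def)
    have f_sub: "f L x = f K x" if "K \<in> I" "L \<in> I" "L \<subseteq> K" "x \<in> D K" for K L x
      using fun_cong[OF f_restrict[OF that(1-3)], of x] that(4) by simp
    have f_eq: "f K x = f L x" if KL: "K \<in> I" "L \<in> I" and x: "x \<in> D K" "x \<in> D L" for K L x
    proof -
      obtain P where "P \<in> I" "P \<subseteq> K" "P \<subseteq> L" using directed[OF KL] by blast
      then show ?thesis using f_sub KL x by metis
    qed
    \<comment> \<open>By \<open>f_eq\<close> the value is the same for all levels containing the vector.\<close>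
    define \<alpha> where "\<alpha> = (\<lambda>x\<in>carrier V. f (SOME K. K \<in> I \<and> x \<in> D K) x)"
    have \<alpha>_eq: "\<alpha> x = f K x" if K: "K \<in> I" "x \<in> D K" for K x
    proof -
      have "(SOME K. K \<in> I \<and> x \<in> D K) \<in> I \<and> x \<in> D (SOME K. K \<in> I \<and> x \<in> D K)"
        using K by (intro someI[of "\<lambda>K. K \<in> I \<and> x \<in> D K"]) auto
      moreover have "x \<in> carrier V" using K cover by auto
      ultimately show ?thesis using f_eq[of "SOME K. K \<in> I \<and> x \<in> D K" K x] K by (simp add: \<alpha>_def)
    qed
    have "\<alpha> \<in> norms k v V"
      unfolding norms_def
    proof (intro CollectI conjI ballI impI)
      show "\<alpha> \<in> carrier V \<rightarrow>\<^sub>E {0..}"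
      proof (rule PiE_I)
        fix x assume "x \<in> carrier V"
        then obtain K where K: "K \<in> I" "x \<in> D K" using cover by auto
        then have "0 \<le> f K x" using fK[OF K(1)] by (auto simp: norms_def)
        then show "\<alpha> x \<in> {0..}" using \<alpha>_eq[OF K] by simp
      qed (simp add: \<alpha>_def)
    next
      fix c x assume c: "c \<in> carrier k" and "x \<in> carrier V"
      then obtain K where K: "K \<in> I" "x \<in> D K" using cover by auto
      then have "f K (c \<odot>\<^bsub>V\<^esub> x) = v c * f K x" using fK[OF K(1)] c by (auto simp: norms_def)
      then show "\<alpha> (c \<odot>\<^bsub>V\<^esub> x) = v c * \<alpha> x"
        using \<alpha>_eq[OF K] \<alpha>_eq[OF K(1) smult[OF K(1) c K(2)]] by simp
    next
      fix x y assume "x \<in> carrier V" "y \<in> carrier V"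
      then obtain K L where KL: "K \<in> I" "x \<in> D K" "L \<in> I" "y \<in> D L" using cover by auto
      then obtain P where P: "P \<in> I" "P \<subseteq> K" "P \<subseteq> L" using directed by blast
      have xy: "x \<in> D P" "y \<in> D P" using antimono KL P by blast+
      then have "f P (x \<oplus>\<^bsub>V\<^esub> y) \<le> max (f P x) (f P y)"
        using fK[OF P(1)] by (auto simp: norms_def)
      then show "\<alpha> (x \<oplus>\<^bsub>V\<^esub> y) \<le> max (\<alpha> x) (\<alpha> y)"
        using \<alpha>_eq[OF P(1)] xy add[OF P(1) xy] by simp
    next
      fix x assume "x \<in> carrier V" and zero: "\<alpha> x = 0"
      then obtain K where K: "K \<in> I" "x \<in> D K" using cover by auto
      then have "f K x = 0" using zero \<alpha>_eq by simp
      then show "x = \<zero>\<^bsub>V\<^esub>" using fK[OF K(1)] K(2) by (auto simp: norms_def)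
    qed
    moreover have "f = (\<lambda>K\<in>I. restrict \<alpha> (D K))"
    proof (rule extensionalityI[of _ I])
      show "f \<in> extensional I" using f by (auto simp: restriction_limit_def PiE_def)
      fix K assume K: "K \<in> I"
      have "f K \<in> extensional (D K)" using fK[OF K] by (auto simp: norms_def PiE_def)
      then have "f K = restrict \<alpha> (D K)"
        by (rule extensionalityI) (auto simp: \<alpha>_eq[OF K])
      then show "f K = (\<lambda>K\<in>I. restrict \<alpha> (D K)) K" using K by simp
    qed simp
    ultimately show "f \<in> (\<lambda>\<alpha>. \<lambda>K\<in>I. restrict \<alpha> (D K)) ` norms k v V" by blast
  qed
qed

lemma d_infty_union:
  assumes "carrier V = (\<Union>K\<in>I. D K)"
  shows "d_infty V \<alpha> \<beta> =
    (SUP K\<in>I. d_infty (V\<lparr>carrier := D K\<rparr>) (restrict \<alpha> (D K)) (restrict \<beta> (D K)))"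
proof -
  have "carrier V - {\<zero>\<^bsub>V\<^esub>} = (\<Union>K\<in>I. D K - {\<zero>\<^bsub>V\<^esub>})" using assms by auto
  then have "d_infty V \<alpha> \<beta> = (SUP K\<in>I. SUP x\<in>D K - {\<zero>\<^bsub>V\<^esub>}. ennreal \<bar>ln (\<alpha> x / \<beta> x)\<bar>)"
    unfolding d_infty_def by (simp only: SUP_UNION)
  also have "\<dots> = (SUP K\<in>I. d_infty (V\<lparr>carrier := D K\<rparr>) (restrict \<alpha> (D K)) (restrict \<beta> (D K)))"
    unfolding d_infty_def by (intro SUP_cong) auto
  finally show ?thesis .
qed


section \<open>Tensor products with a directed union of subsets\<close>

lemma free_module_memI:
  assumes "cring K" and u: "u \<in> carrier (free_module K M N)" and w: "w \<in> carrier (free_module K M N)"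
    and "\<And>z. t z \<in> carrier K"
    and t: "\<And>z. u z = \<zero>\<^bsub>K\<^esub> \<Longrightarrow> w z = \<zero>\<^bsub>K\<^esub> \<Longrightarrow> t z = \<zero>\<^bsub>K\<^esub>"
  shows "t \<in> carrier (free_module K M N)"
proof -
  have sub: "{z. t z \<noteq> \<zero>\<^bsub>K\<^esub>} \<subseteq> {z. u z \<noteq> \<zero>\<^bsub>K\<^esub>} \<union> {z. w z \<noteq> \<zero>\<^bsub>K\<^esub>}" using t by auto
  have "finite ({z. u z \<noteq> \<zero>\<^bsub>K\<^esub>} \<union> {z. w z \<noteq> \<zero>\<^bsub>K\<^esub>})" using u w by (auto simp: free_module_def)
  then have "finite {z. t z \<noteq> \<zero>\<^bsub>K\<^esub>}" by (rule finite_subset[OF sub])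
  moreover have "{z. t z \<noteq> \<zero>\<^bsub>K\<^esub>} \<subseteq> carrier M \<times> carrier N"
    using u w by (intro subset_trans[OF sub]) (auto simp: free_module_def)
  ultimately show ?thesis using assms(4) by (simp add: free_module_def)
qed

lemma free_module_simps:
  "add (free_module K M N) = (\<lambda>u v z. u z \<oplus>\<^bsub>K\<^esub> v z)"
  "ring.zero (free_module K M N) = (\<lambda>z. \<zero>\<^bsub>K\<^esub>)"
  "smult (free_module K M N) = (\<lambda>c u z. c \<otimes>\<^bsub>K\<^esub> u z)"
  by (simp_all add: free_module_def)

lemma free_module_value: "u \<in> carrier (free_module K M N) \<Longrightarrow> u z \<in> carrier K"
  by (cases z) (simp add: free_module_def)

lemma free_module_module:
  assumes "cring K"
  shows "module K (free_module K M N)"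
proof -
  interpret K: cring K by fact
  let ?F = "free_module K M N"
  note mem = free_module_memI[OF assms, of _ M N]
  have coeffs: "\<forall>a b. u (a, b) \<in> carrier K" if "u \<in> carrier ?F" for u
    using free_module_value[OF that] by simp
  note [simp] = free_module_simps
  have "abelian_group ?F"
  proof (rule abelian_groupI)
    fix u v assume uv: "u \<in> carrier ?F" "v \<in> carrier ?F"
    note [simp] = free_module_value[OF uv(1)] free_module_value[OF uv(2)]
    show "u \<oplus>\<^bsub>?F\<^esub> v \<in> carrier ?F" by (rule mem[OF uv]) simp_all
    show "u \<oplus>\<^bsub>?F\<^esub> v = v \<oplus>\<^bsub>?F\<^esub> u" by (simp add: K.a_comm)
    fix w assume w: "w \<in> carrier ?F"
    show "u \<oplus>\<^bsub>?F\<^esub> v \<oplus>\<^bsub>?F\<^esub> w = u \<oplus>\<^bsub>?F\<^esub> (v \<oplus>\<^bsub>?F\<^esub> w)"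
      by (simp add: K.a_assoc free_module_value[OF w])
  next
    show "\<zero>\<^bsub>?F\<^esub> \<in> carrier ?F" by (simp add: free_module_def)
  next
    fix u assume u: "u \<in> carrier ?F"
    note [simp] = free_module_value[OF u]
    show "\<zero>\<^bsub>?F\<^esub> \<oplus>\<^bsub>?F\<^esub> u = u" by simp
    have "(\<lambda>z. \<ominus>\<^bsub>K\<^esub> u z) \<in> carrier ?F" by (rule mem[OF u u]) simp_all
    then show "\<exists>y\<in>carrier ?F. y \<oplus>\<^bsub>?F\<^esub> u = \<zero>\<^bsub>?F\<^esub>"
      by (rule rev_bexI) (simp add: K.l_neg)
  qed
  moreover have "c \<odot>\<^bsub>?F\<^esub> u \<in> carrier ?F" if c: "c \<in> carrier K" and u: "u \<in> carrier ?F" for c u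
    by (rule mem[OF u u]) (simp_all add: c free_module_value[OF u])
  ultimately show ?thesis
    by (intro moduleI assms)
      (auto simp: fun_eq_iff K.l_distr K.r_distr K.m_assoc dest!: coeffs)
qed

lemma bilinearity_relations_subset:
  assumes "module K M" and "module K N"
  shows "bilinearity_relations K M N \<subseteq> carrier (free_module K M N)"
proof -
  interpret M: module K M by fact
  interpret N: module K N by fact
  let ?F = "free_module K M N"
  interpret F: module K ?F by (rule free_module_module) (rule M.is_cring)
  have delta: "delta K x y \<in> carrier ?F" if "x \<in> carrier M" "y \<in> carrier N" for x y
    using that by (auto simp: free_module_def delta_def)
  have diff: "(\<lambda>z. u z \<ominus>\<^bsub>K\<^esub> w z) \<in> carrier ?F" if "u \<in> carrier ?F" "w \<in> carrier ?F" for u w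
    using that free_module_value[OF that(1)] free_module_value[OF that(2)]
    by (intro free_module_memI[OF M.is_cring that]) (auto simp: a_minus_def)
  have sum: "(\<lambda>z. u z \<oplus>\<^bsub>K\<^esub> w z) \<in> carrier ?F" if "u \<in> carrier ?F" "w \<in> carrier ?F" for u w
    using F.add.m_closed[OF that] by (simp add: free_module_simps)
  have scal: "(\<lambda>z. c \<otimes>\<^bsub>K\<^esub> u z) \<in> carrier ?F" if "c \<in> carrier K" "u \<in> carrier ?F" for c u
    using F.smult_closed[OF that] by (simp add: free_module_simps)
  show ?thesis
    unfolding bilinearity_relations_def by (auto intro!: diff sum scal delta)
qed

text \<open>An intersection of submodules is a submodule only when the family is nonempty; here the whole
  free module belongs to it.\<close>

lemma submodule_tensor_rel:
  assumes "module K M" and "module K N"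
  shows "submodule (tensor_rel K M N) K (free_module K M N)"
proof -
  interpret M: module K M by fact
  let ?F = "free_module K M N"
  interpret F: module K ?F by (rule free_module_module) (rule M.is_cring)
  let ?S = "{H. submodule H K ?F \<and> bilinearity_relations K M N \<subseteq> H}"
  have carrier: "carrier ?F \<in> ?S"
    using F.carrier_is_submodule bilinearity_relations_subset[OF assms] by auto
  have "submodule (\<Inter>?S) K ?F"
  proof (rule F.submoduleI)
    show "\<Inter>?S \<subseteq> carrier ?F" using carrier by blast
    show "\<zero>\<^bsub>?F\<^esub> \<in> \<Inter>?S" using subgroup.one_closed submodule.axioms(1) by fastforce
  qed (use F.submoduleE in auto)
  then show ?thesis by (simp add: tensor_rel_def hull_def)
qed

lemma abelian_subgroup_tensor_rel:
  assumes "module K M" and "module K N"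
  shows "abelian_subgroup (tensor_rel K M N) (free_module K M N)"
proof -
  interpret M: module K M by fact
  interpret F: module K "free_module K M N" by (rule free_module_module) (rule M.is_cring)
  have "additive_subgroup (tensor_rel K M N) (free_module K M N)"
    using submodule.axioms(1)[OF submodule_tensor_rel[OF assms]] by (rule additive_subgroup.intro)
  then show ?thesis using module.axioms(2)[OF F.module_axioms] by (rule abelian_subgroupI3)
qed

lemma tensor_simps:
  "carrier (tensor K M N) = (\<lambda>u. tensor_rel K M N +>\<^bsub>free_module K M N\<^esub> u) ` carrier (free_module K M N)"
  "add (tensor K M N) = set_add (free_module K M N)"
  by (auto simp: tensor_def with_smult_def FactRing_def A_RCOSETS_def')

text \<open>The scalar multiple of a coset is the union of the cosets of the multiples of all its
  representatives. These cosets coincide since the relations are stable under scalars.\<close>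

lemma tensor_smult_coset:
  assumes "module K M" and "module K N" and c: "c \<in> carrier K" and u: "u \<in> carrier (free_module K M N)"
  shows "c \<odot>\<^bsub>tensor K M N\<^esub> (tensor_rel K M N +>\<^bsub>free_module K M N\<^esub> u) =
    tensor_rel K M N +>\<^bsub>free_module K M N\<^esub> (c \<odot>\<^bsub>free_module K M N\<^esub> u)"
proof -
  interpret M: module K M by fact
  let ?F = "free_module K M N" and ?H = "tensor_rel K M N"
  interpret F: module K ?F by (rule free_module_module) (rule M.is_cring)
  interpret H: abelian_subgroup ?H ?F by (rule abelian_subgroup_tensor_rel) fact+
  interpret S: submodule ?H K ?F by (rule submodule_tensor_rel) fact+
  have same: "?H +>\<^bsub>?F\<^esub> (c \<odot>\<^bsub>?F\<^esub> u') = ?H +>\<^bsub>?F\<^esub> (c \<odot>\<^bsub>?F\<^esub> u)" if u': "u' \<in> ?H +>\<^bsub>?F\<^esub> u" for u'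
  proof -
    obtain h where h: "h \<in> ?H" "u' = h \<oplus>\<^bsub>?F\<^esub> u" using u' by (auto simp: a_r_coset_def')
    have hF: "h \<in> carrier ?F" using h(1) by (rule H.a_Hcarr)
    have "c \<odot>\<^bsub>?F\<^esub> u' = (c \<odot>\<^bsub>?F\<^esub> h) \<oplus>\<^bsub>?F\<^esub> (c \<odot>\<^bsub>?F\<^esub> u)"
      unfolding h(2) using c hF u by (rule F.smult_r_distr)
    then have "c \<odot>\<^bsub>?F\<^esub> u' \<in> ?H +>\<^bsub>?F\<^esub> (c \<odot>\<^bsub>?F\<^esub> u)"
      using S.smult_closed[OF c h(1)] by (auto simp: a_r_coset_def')
    then show ?thesis using F.smult_closed[OF c u] H.a_repr_independence' by metis
  qed
  have "c \<odot>\<^bsub>tensor K M N\<^esub> (?H +>\<^bsub>?F\<^esub> u) = (\<Union>u'\<in>?H +>\<^bsub>?F\<^esub> u. ?H +>\<^bsub>?F\<^esub> (c \<odot>\<^bsub>?F\<^esub> u'))"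
    by (simp add: tensor_def with_smult_def)
  also have "\<dots> = (\<Union>u'\<in>?H +>\<^bsub>?F\<^esub> u. ?H +>\<^bsub>?F\<^esub> (c \<odot>\<^bsub>?F\<^esub> u))"
    using same by (intro SUP_cong) auto
  also have "\<dots> = ?H +>\<^bsub>?F\<^esub> (c \<odot>\<^bsub>?F\<^esub> u)" using H.a_rcos_self[OF u] by blast
  finally show ?thesis .
qed

lemma free_module_mono:
  assumes "U \<subseteq> U'"
  shows "carrier (free_module K (M\<lparr>carrier := U\<rparr>) N) \<subseteq> carrier (free_module K (M\<lparr>carrier := U'\<rparr>) N)"
  using assms by (auto simp: free_module_def)

text \<open>In this form closure under addition and scalars is inherited from the free module on
  \<open>U \<times> carrier N\<close>.\<close>

lemma tensor_subspace_eq_image: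
  assumes "module K M" and "module K N" and U: "U \<subseteq> carrier M"
  shows "tensor_subspace K M N U =
    (\<lambda>u. tensor_rel K M N +>\<^bsub>free_module K M N\<^esub> u) ` carrier (free_module K (M\<lparr>carrier := U\<rparr>) N)"
proof -
  let ?F = "free_module K M N" and ?H = "tensor_rel K M N"
  interpret H: abelian_subgroup ?H ?F by (rule abelian_subgroup_tensor_rel) fact+
  have sub: "carrier (free_module K (M\<lparr>carrier := U\<rparr>) N) \<subseteq> carrier ?F"
    using free_module_mono[OF U, of K M N] by simp
  show ?thesis
  proof (intro equalityI subsetI)
    fix \<xi> assume "\<xi> \<in> tensor_subspace K M N U"
    then obtain w u where w: "w \<in> carrier ?F" "\<xi> = ?H +>\<^bsub>?F\<^esub> w"
      and u: "u \<in> \<xi>" "u \<in> carrier (free_module K (M\<lparr>carrier := U\<rparr>) N)"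
      by (auto simp: tensor_subspace_def tensor_simps)
    have "\<xi> = ?H +>\<^bsub>?F\<^esub> u" using H.a_repr_independence'[of u w] w u by auto
    then show "\<xi> \<in> (\<lambda>u. ?H +>\<^bsub>?F\<^esub> u) ` carrier (free_module K (M\<lparr>carrier := U\<rparr>) N)" using u by blast
  next
    fix \<xi> assume "\<xi> \<in> (\<lambda>u. ?H +>\<^bsub>?F\<^esub> u) ` carrier (free_module K (M\<lparr>carrier := U\<rparr>) N)"
    then obtain u where u: "u \<in> carrier (free_module K (M\<lparr>carrier := U\<rparr>) N)" "\<xi> = ?H +>\<^bsub>?F\<^esub> u" by auto
    then have "u \<in> carrier ?F" using sub by auto
    then show "\<xi> \<in> tensor_subspace K M N U"
      using u H.a_rcos_self[of u] by (auto simp: tensor_subspace_def tensor_simps)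
  qed
qed

lemma tensor_subspace_closed:
  assumes "module K M" and "module K N" and U: "U \<subseteq> carrier M"
  shows "\<xi> \<in> tensor_subspace K M N U \<Longrightarrow> \<eta> \<in> tensor_subspace K M N U \<Longrightarrow>
      \<xi> \<oplus>\<^bsub>tensor K M N\<^esub> \<eta> \<in> tensor_subspace K M N U"
    and "c \<in> carrier K \<Longrightarrow> \<xi> \<in> tensor_subspace K M N U \<Longrightarrow>
      c \<odot>\<^bsub>tensor K M N\<^esub> \<xi> \<in> tensor_subspace K M N U"
proof -
  interpret M: module K M by fact
  let ?F = "free_module K M N" and ?H = "tensor_rel K M N" and ?FU = "free_module K (M\<lparr>carrier := U\<rparr>) N"
  interpret FU: module K ?FU by (rule free_module_module) (rule M.is_cring)
  interpret H: abelian_subgroup ?H ?F by (rule abelian_subgroup_tensor_rel) fact+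
  have sub: "carrier ?FU \<subseteq> carrier ?F"
    using free_module_mono[OF U, of K M N] by simp
  note image = tensor_subspace_eq_image[OF assms]
  {
    assume "\<xi> \<in> tensor_subspace K M N U" "\<eta> \<in> tensor_subspace K M N U"
    then obtain u w where uw: "u \<in> carrier ?FU" "w \<in> carrier ?FU"
      "\<xi> = ?H +>\<^bsub>?F\<^esub> u" "\<eta> = ?H +>\<^bsub>?F\<^esub> w" unfolding image by auto
    then have "\<xi> \<oplus>\<^bsub>tensor K M N\<^esub> \<eta> = ?H +>\<^bsub>?F\<^esub> (u \<oplus>\<^bsub>?FU\<^esub> w)"
      using H.a_rcos_sum[of u w] sub by (auto simp: tensor_simps free_module_simps)
    then show "\<xi> \<oplus>\<^bsub>tensor K M N\<^esub> \<eta> \<in> tensor_subspace K M N U"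
      using FU.add.m_closed[OF uw(1,2)] unfolding image by auto
  }
  {
    assume c: "c \<in> carrier K" and "\<xi> \<in> tensor_subspace K M N U"
    then obtain u where u: "u \<in> carrier ?FU" "\<xi> = ?H +>\<^bsub>?F\<^esub> u" unfolding image by auto
    then have "c \<odot>\<^bsub>tensor K M N\<^esub> \<xi> = ?H +>\<^bsub>?F\<^esub> (c \<odot>\<^bsub>?FU\<^esub> u)"
      using tensor_smult_coset[OF assms(1,2) c, of u] sub by (auto simp: free_module_simps)
    then show "c \<odot>\<^bsub>tensor K M N\<^esub> \<xi> \<in> tensor_subspace K M N U"
      using FU.smult_closed[OF c u(1)] unfolding image by auto
  }
qed

lemma finite_subset_directed_UN:
  assumes "finite S" and "S \<subseteq> (\<Union>i\<in>I. U i)" and "I \<noteq> {}"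
    and directed: "\<And>i j. i \<in> I \<Longrightarrow> j \<in> I \<Longrightarrow> \<exists>l\<in>I. U i \<union> U j \<subseteq> U l"
  shows "\<exists>i\<in>I. S \<subseteq> U i"
  using assms(1,2)
proof (induction S)
  case empty
  then show ?case using \<open>I \<noteq> {}\<close> by auto
next
  case (insert x S)
  then obtain i j where ij: "i \<in> I" "S \<subseteq> U i" "j \<in> I" "x \<in> U j" by auto
  then show ?case using directed[of i j] by auto
qed

text \<open>A representative of a tensor has finite support, so the left factors that it involves lie in
  one member of the directed family.\<close>

lemma tensor_carrier_directed_union:
  assumes "module K M" and "module K N"
    and cover: "carrier M = (\<Union>i\<in>I. U i)" and "I \<noteq> {}"
    and directed: "\<And>i j. i \<in> I \<Longrightarrow> j \<in> I \<Longrightarrow> \<exists>l\<in>I. U i \<union> U j \<subseteq> U l"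
  shows "carrier (tensor K M N) = (\<Union>i\<in>I. tensor_subspace K M N (U i))"
proof -
  have "carrier (free_module K M N) = (\<Union>i\<in>I. carrier (free_module K (M\<lparr>carrier := U i\<rparr>) N))"
  proof (intro equalityI subsetI)
    fix u assume u: "u \<in> carrier (free_module K M N)"
    let ?S = "fst ` {z. u z \<noteq> \<zero>\<^bsub>K\<^esub>}"
    have "finite ?S" "?S \<subseteq> (\<Union>i\<in>I. U i)"
      using u unfolding cover[symmetric] by (auto simp: free_module_def)
    then obtain i where "i \<in> I" "?S \<subseteq> U i"
      using finite_subset_directed_UN[of ?S U I] \<open>I \<noteq> {}\<close> directed by blast
    then show "u \<in> (\<Union>i\<in>I. carrier (free_module K (M\<lparr>carrier := U i\<rparr>) N))"
      using u by (force simp: free_module_def)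
  next
    fix u assume "u \<in> (\<Union>i\<in>I. carrier (free_module K (M\<lparr>carrier := U i\<rparr>) N))"
    then show "u \<in> carrier (free_module K M N)"
      using cover by (auto simp: free_module_def)
  qed
  moreover have "tensor_subspace K M N (U i) =
      (\<lambda>u. tensor_rel K M N +>\<^bsub>free_module K M N\<^esub> u) ` carrier (free_module K (M\<lparr>carrier := U i\<rparr>) N)"
    if "i \<in> I" for i
    using that cover by (intro tensor_subspace_eq_image assms) auto
  ultimately show ?thesis by (auto simp: tensor_simps)
qed


section \<open>Compact open subgroups\<close>

text \<open>Writing \<open>\<Delta> a = \<Sum> x\<^sub>i \<otimes> y\<^sub>i\<close>, the value \<open>(hg)(a) = \<Sum> h(x\<^sub>i) g(y\<^sub>i)\<close> equals \<open>g(b)\<close> for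
  \<open>b = \<Sum> h(x\<^sub>i) y\<^sub>i\<close>, because \<open>g\<close> is linear. That \<open>b\<close> depends on \<open>h\<close> and \<open>a\<close> alone is what makes
  translation by \<open>h\<close> continuous.\<close>

lemma rational_points_mult:
  assumes hopf: "hopf_algebra F A \<Delta> \<epsilon>"
    and h: "h \<in> carrier (rational_points F A \<Delta> \<epsilon>)" and a: "a \<in> carrier A"
  shows "\<exists>b\<in>carrier A. \<forall>g\<in>carrier (rational_points F A \<Delta> \<epsilon>).
    (h \<otimes>\<^bsub>rational_points F A \<Delta> \<epsilon>\<^esub> g) a = g b"
proof -
  have alg: "Module.algebra F A" using hopf by (simp add: hopf_algebra_def)
  interpret A: Module.algebra F A by fact
  interpret AA: abelian_subgroup "tensor_rel F A A" "free_module F A A"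
    by (rule abelian_subgroup_tensor_rel; rule A.module)
  \<comment> \<open>The representative of \<open>\<Delta> a\<close> on which \<^const>\<open>tensor_lift\<close> evaluates.\<close>
  let ?u = "SOME u. u \<in> \<Delta> a"
  have "\<Delta> a \<in> carrier (tensor F A A)"
    using hopf a by (auto simp: hopf_algebra_def algebra_homs_def linear_maps_def)
  then obtain w where w: "w \<in> carrier (free_module F A A)"
    "\<Delta> a = tensor_rel F A A +>\<^bsub>free_module F A A\<^esub> w" by (auto simp: tensor_simps)
  have "?u \<in> \<Delta> a" using AA.a_rcos_self[OF w(1)] w(2) by (intro someI[of "\<lambda>u. u \<in> \<Delta> a"]) simp
  then have u: "?u \<in> carrier (free_module F A A)" using AA.a_elemrcos_carrier w by blast
  let ?Z = "{z. ?u z \<noteq> \<zero>\<^bsub>F\<^esub>}"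
  have Z: "?Z \<subseteq> carrier A \<times> carrier A" using u by (simp add: free_module_def)
  have uF: "?u z \<in> carrier F" for z using u by (rule free_module_value)
  have hF: "h x \<in> carrier F" if "x \<in> carrier A" for x
    using h that by (auto simp: rational_points_def point_group_def algebra_homs_def linear_maps_def
        self_algebra_def with_smult_def)
  let ?c = "\<lambda>z. ?u z \<otimes>\<^bsub>F\<^esub> h (fst z)"
  let ?b = "\<Oplus>\<^bsub>A\<^esub>z\<in>?Z. ?c z \<odot>\<^bsub>A\<^esub> snd z"
  have cF: "?c z \<in> carrier F" if "z \<in> ?Z" for z
  proof -
    have "fst z \<in> carrier A" using that Z by auto
    then show ?thesis using uF hF by blast
  qed
  have term_in: "?c z \<odot>\<^bsub>A\<^esub> snd z \<in> carrier A" if "z \<in> ?Z" for z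
    using cF[OF that] that Z by (intro A.smult_closed) auto
  have "(h \<otimes>\<^bsub>rational_points F A \<Delta> \<epsilon>\<^esub> g) a = g ?b" if g: "g \<in> carrier (rational_points F A \<Delta> \<epsilon>)" for g
  proof -
    have gh: "g \<in> ring_hom A F"
      and glin: "\<And>c x. c \<in> carrier F \<Longrightarrow> x \<in> carrier A \<Longrightarrow> g (c \<odot>\<^bsub>A\<^esub> x) = c \<otimes>\<^bsub>F\<^esub> g x"
      using g by (auto simp: rational_points_def point_group_def algebra_homs_def linear_maps_def
          self_algebra_def with_smult_def ring_hom_def)
    interpret g: ring_hom_cring A F g
      by (intro ring_hom_cring.intro ring_hom_cring_axioms.intro A.M_cring A.R_cring gh)
    have "g ?b = (\<Oplus>\<^bsub>F\<^esub>z\<in>?Z. g (?c z \<odot>\<^bsub>A\<^esub> snd z))"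
      using term_in by (subst g.hom_finsum) (auto simp: o_def)
    also have "\<dots> = (\<Oplus>\<^bsub>F\<^esub>z\<in>?Z. ?u z \<otimes>\<^bsub>F\<^esub> (h (fst z) \<otimes>\<^bsub>F\<^esub> g (snd z)))"
    proof (rule A.R.finsum_cong')
      fix z assume z: "z \<in> ?Z"
      then have "fst z \<in> carrier A" "snd z \<in> carrier A" using Z by auto
      then show "g (?c z \<odot>\<^bsub>A\<^esub> snd z) = ?u z \<otimes>\<^bsub>F\<^esub> (h (fst z) \<otimes>\<^bsub>F\<^esub> g (snd z))"
        using cF[OF z] uF hF by (simp add: glin A.R.m_assoc)
    next
      show "(\<lambda>z. ?u z \<otimes>\<^bsub>F\<^esub> (h (fst z) \<otimes>\<^bsub>F\<^esub> g (snd z))) \<in> ?Z \<rightarrow> carrier F"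
        using Z uF hF by (auto simp: subset_iff)
    qed simp
    also have "\<dots> = (h \<otimes>\<^bsub>rational_points F A \<Delta> \<epsilon>\<^esub> g) a"
      using a by (simp add: rational_points_def point_group_def tensor_lift_def self_algebra_def
          with_smult_def Let_def finsum_def finprod_def)
    finally show ?thesis by simp
  qed
  moreover have "?b \<in> carrier A" using term_in by (intro A.M.finsum_closed) auto
  ultimately show ?thesis by blast
qed

text \<open>Each coordinate \<open>g \<mapsto> (hg)(a)\<close> of the translation is itself a coordinate \<open>g \<mapsto> g(b)\<close>, and
  coordinates are continuous by the definition of the topology.\<close>

lemma continuous_map_left_translation:
  assumes hopf: "hopf_algebra F A \<Delta> \<epsilon>" and G: "G = rational_points F A \<Delta> \<epsilon>" and "group G"
    and h: "h \<in> carrier G"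
  shows "continuous_map (points_topology F v (carrier A) (carrier G))
    (points_topology F v (carrier A) (carrier G)) (\<lambda>g. h \<otimes>\<^bsub>G\<^esub> g)"
proof -
  interpret G: group G by fact
  let ?X = "Metric_space.mtopology (carrier F) (\<lambda>x y. v (x \<ominus>\<^bsub>F\<^esub> y))"
  let ?P = "product_topology (\<lambda>_. ?X) (carrier A)"
  define T where "T = points_topology F v (carrier A) (carrier G)"
  have T: "T = subtopology ?P (carrier G)" by (simp add: T_def points_topology_def)
  have top: "topspace T \<subseteq> carrier G" by (simp add: T)
  have closed: "h \<otimes>\<^bsub>G\<^esub> g \<in> carrier G" if "g \<in> topspace T" for g
    using h that top by auto
  have ext: "carrier G \<subseteq> extensional (carrier A)"
    by (auto simp: G rational_points_def point_group_def)
  have comp: "continuous_map T ?X (\<lambda>g. (h \<otimes>\<^bsub>G\<^esub> g) a)" if a: "a \<in> carrier A" for a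
  proof -
    obtain b where b: "b \<in> carrier A" "\<forall>g\<in>carrier G. (h \<otimes>\<^bsub>G\<^esub> g) a = g b"
      using rational_points_mult[OF hopf _ a] h unfolding G by blast
    have "continuous_map T ?X (\<lambda>g. g b)"
      unfolding T using b(1)
      by (intro continuous_map_from_subtopology continuous_map_product_projection)
    then show ?thesis
      by (rule continuous_map_eq) (use b(2) top in auto)
  qed
  have "continuous_map T ?P (\<lambda>g. h \<otimes>\<^bsub>G\<^esub> g)"
    unfolding continuous_map_componentwise using comp closed ext by auto
  then have "continuous_map T (subtopology ?P (carrier G)) (\<lambda>g. h \<otimes>\<^bsub>G\<^esub> g)"
    unfolding continuous_map_in_subtopology using closed by auto
  then show ?thesis using T T_def by simp
qed

text \<open>A point \<open>x\<close> outside \<open>K\<close> has the coset \<open>xK\<close> as a neighbourhood disjoint from \<open>K\<close>. It is open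
  as the preimage of \<open>K\<close> under translation by the inverse of \<open>x\<close>.\<close>

lemma open_subgroup_closedin:
  assumes "group G" and top: "topspace T \<subseteq> carrier G"
    and cont: "\<And>h. h \<in> carrier G \<Longrightarrow> continuous_map T T (\<lambda>g. h \<otimes>\<^bsub>G\<^esub> g)"
    and K: "subgroup K G" and op: "openin T K"
  shows "closedin T K"
proof -
  interpret G: group G by fact
  interpret K: subgroup K G by fact
  have "\<exists>U. openin T U \<and> x \<in> U \<and> U \<subseteq> topspace T - K" if x: "x \<in> topspace T - K" for x
  proof (intro exI conjI)
    let ?U = "{y \<in> topspace T. inv\<^bsub>G\<^esub> x \<otimes>\<^bsub>G\<^esub> y \<in> K}"
    have xG: "x \<in> carrier G" using x top by auto
    show "openin T ?U"
      using cont[of "inv\<^bsub>G\<^esub> x"] xG op by (auto simp: continuous_map)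
    show "x \<in> ?U" using x xG by simp
    show "?U \<subseteq> topspace T - K"
    proof
      fix y assume y: "y \<in> ?U"
      have "x \<in> K" if "y \<in> K"
      proof -
        have "inv\<^bsub>G\<^esub> x = (inv\<^bsub>G\<^esub> x \<otimes>\<^bsub>G\<^esub> y) \<otimes>\<^bsub>G\<^esub> inv\<^bsub>G\<^esub> y"
          using xG K.mem_carrier[OF that] by (simp add: G.m_assoc)
        then have "inv\<^bsub>G\<^esub> x \<in> K" using y that by (metis (lifting) K.m_closed K.m_inv_closed mem_Collect_eq)
        then show "x \<in> K" using K.m_inv_closed[of "inv\<^bsub>G\<^esub> x"] xG by simp
      qed
      then show "y \<in> topspace T - K" using y x by auto
    qed
  qed
  then have "openin T (topspace T - K)" by (subst openin_subopen) blast
  then show ?thesis using op by (simp add: closedin_def openin_subset)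
qed

lemma compact_open_subgroups_Int:
  assumes "hopf_algebra F A \<Delta> \<epsilon>" and G: "G = rational_points F A \<Delta> \<epsilon>" and "group G"
    and "K \<in> compact_open_subgroups G (points_topology F v (carrier A) (carrier G))"
    and "L \<in> compact_open_subgroups G (points_topology F v (carrier A) (carrier G))"
  shows "K \<inter> L \<in> compact_open_subgroups G (points_topology F v (carrier A) (carrier G))"
proof -
  let ?T = "points_topology F v (carrier A) (carrier G)"
  have KL: "subgroup K G" "openin ?T K" "subgroup L G" "openin ?T L" "compactin ?T L"
    using assms(4,5) by (auto simp: compact_open_subgroups_def)
  have "closedin ?T K"
    using assms(3) _ continuous_map_left_translation[OF assms(1-3)] KL(1,2)
    by (rule open_subgroup_closedin) (simp add: points_topology_def)
  then have "compactin ?T (K \<inter> L)" using KL(5) by (rule closed_Int_compactin)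
  moreover have "subgroup (K \<inter> L) G"
    using assms(3) KL(1,3) by (rule group.subgroups_Inter_pair)
  ultimately show ?thesis using KL by (simp add: compact_open_subgroups_def openin_Int)
qed

theorem proposition3p1:
  fixes p :: nat
    and F :: "(padic, 'f) module" and absF :: "'f \<Rightarrow> real"
    and E :: "(padic, 'e) module" and absE :: "'e \<Rightarrow> real"
    and A :: "('f, 'a) module" and \<Delta> :: "'a \<Rightarrow> ('a \<times> 'a \<Rightarrow> 'f) set" and \<epsilon> :: "'a \<Rightarrow> 'f"
    and G :: "('a \<Rightarrow> 'f) monoid" and \<K> :: "('a \<Rightarrow> 'f) set set"
    and M :: "('e, 'm) module" and \<pi> :: "('a \<Rightarrow> 'f) \<Rightarrow> 'm \<Rightarrow> 'm"
    and N :: "('e, 'n) module" and \<sigma> :: "('a \<Rightarrow> 'f) \<Rightarrow> 'n \<Rightarrow> 'n"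
    and V :: "('e, ('m \<times> 'n \<Rightarrow> 'e) set) module"
    and V\<^sub>K :: "('a \<Rightarrow> 'f) set \<Rightarrow> ('e, ('m \<times> 'n \<Rightarrow> 'e) set) module"
  assumes "Factorial_Ring.prime p"
    and "finite_extension (Qp p) F"
    and "finite_extension (Qp p) E"
    and "nonarch_abs F absF"
    and "\<forall>q\<in>carrier (Qp p). absF (q \<odot>\<^bsub>F\<^esub> \<one>\<^bsub>F\<^esub>) = Qp_abs p q"
    and "nonarch_abs E absE" and "nontrivial_abs E absE"
    and "reductive_group F A \<Delta> \<epsilon>"
    and "G = rational_points F A \<Delta> \<epsilon>"
    and "smooth_admissible E G (points_topology F absF (carrier A) (carrier G)) M \<pi>"
    and "algebraic_representation (Qp p) F E A \<Delta> \<epsilon> N \<sigma>" and "finite_dim E N"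
    and "V = tensor E M N"
    and "\<K> = compact_open_subgroups G (points_topology F absF (carrier A) (carrier G))"
    and "V\<^sub>K = level_space E M \<pi> N"
  shows "bij_betw (\<lambda>\<alpha>. \<lambda>K\<in>\<K>. restrict \<alpha> (carrier (V\<^sub>K K)))
           (norms E absE V)
           (restriction_limit \<K> (\<lambda>K. carrier (V\<^sub>K K)) (\<lambda>K. extended_building E absE (V\<^sub>K K)))
       \<and> (\<forall>\<alpha>\<in>norms E absE V. \<forall>\<beta>\<in>norms E absE V.
           d_infty V \<alpha> \<beta> =
             (SUP K\<in>\<K>. d_infty (V\<^sub>K K) (restrict \<alpha> (carrier (V\<^sub>K K))) (restrict \<beta> (carrier (V\<^sub>K K)))))"
proof -
  let ?T = "points_topology F absF (carrier A) (carrier G)"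
  have hopf: "hopf_algebra F A \<Delta> \<epsilon>" using assms(8) by (simp add: reductive_group_def)
  have rep: "representation E G M \<pi>"
    and smooth: "\<And>x. x \<in> carrier M \<Longrightarrow> \<exists>K\<in>\<K>. x \<in> fixed_vectors M \<pi> K"
    using assms(10) unfolding smooth_admissible_def assms(14) by auto
  have M: "module E M" and N: "module E N"
    using rep assms(11) by (auto simp: representation_def algebraic_representation_def)
  have "group G"
    using rep by (auto simp: representation_def group_action_def group_hom_def)
  have Int: "K \<inter> L \<in> \<K>" if "K \<in> \<K>" "L \<in> \<K>" for K L
    using compact_open_subgroups_Int[OF hopf assms(9) \<open>group G\<close>] that unfolding assms(14) by blast
  have fixed_antimono: "fixed_vectors M \<pi> K \<subseteq> fixed_vectors M \<pi> L" if "L \<subseteq> K" for K L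
    using that by (auto simp: fixed_vectors_def)
  have fixed_sub: "fixed_vectors M \<pi> K \<subseteq> carrier M" for K by (auto simp: fixed_vectors_def)
  interpret M: module E M by (rule M)
  have "\<K> \<noteq> {}" using smooth[OF M.zero_closed] by auto
  have fixed_directed: "\<exists>P\<in>\<K>. fixed_vectors M \<pi> K \<union> fixed_vectors M \<pi> L \<subseteq> fixed_vectors M \<pi> P"
    if "K \<in> \<K>" "L \<in> \<K>" for K L
    using Int[OF that] fixed_antimono[of "K \<inter> L"] by (intro bexI[of _ "K \<inter> L"]) auto
  let ?D = "\<lambda>K. tensor_subspace E M N (fixed_vectors M \<pi> K)"
  have VK: "V\<^sub>K K = V\<lparr>carrier := ?D K\<rparr>" for K by (simp add: assms(13,15) level_space_def)
  have cover: "carrier V = (\<Union>K\<in>\<K>. ?D K)"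
    unfolding assms(13) using M N _ \<open>\<K> \<noteq> {}\<close> fixed_directed
    by (rule tensor_carrier_directed_union) (use smooth fixed_sub in blast)
  have antimono: "?D K \<subseteq> ?D L" if "L \<subseteq> K" for K L
    using free_module_mono[OF fixed_antimono[OF that], of E M N]
    by (auto simp: tensor_subspace_def)
  have "bij_betw (\<lambda>\<alpha>. \<lambda>K\<in>\<K>. restrict \<alpha> (?D K)) (norms E absE V)
      (restriction_limit \<K> ?D (\<lambda>K. norms E absE (V\<lparr>carrier := ?D K\<rparr>)))"
  proof (rule norms_on_directed_union[OF cover])
    show "\<exists>P\<in>\<K>. P \<subseteq> K \<and> P \<subseteq> L" if "K \<in> \<K>" "L \<in> \<K>" for K L
      using Int[OF that] by blast
  qed (use antimono tensor_subspace_closed[OF M N fixed_sub] in \<open>auto simp: assms(13)\<close>)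
  then show ?thesis
    using d_infty_union[OF cover] by (simp add: VK extended_building_def)
qed

end
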